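(* The complete graph $K_4$ is rigid in every normed plane $X$; that is, for every 2-dimensional real normed space $X$ there exists a placement $p$ of $K_4$ such that $(K_4,p)$ is infinitesimally rigid in $X$.
   Context: A normed plane is a 2-dimensional real normed space $(X,\|\cdot\|)$; it is Euclidean if its norm is induced by an inner product and non-Euclidean otherwise. A support functional of $x\in X$ is an $f\in X^*$ with $\|f\|=\|x\|$ and $f(x)=\|x\|^2$. A nonzero $x\in X$ is smooth if it has exactly one support functional, denoted $\varphi(x)$. Graphs are finite and simple. A framework in $X$ is a pair $(G,p)$ with $p=(p_v)_{v\in V(G)}\in X^{V(G)}$ (a placement of $G$). It is well-positioned if $p_v-p_w$ is smooth for every edge $vw$; then put $\varphi_{v,w}:=\varphi\big((p_v-p_w)/\|p_v-p_w\|\big)$ and define the rigidity operator $df_G(p):X^{V(G)}\to\mathbb{R}^{E(G)}$, $u\mapsto(\varphi_{v,w}(u_v-u_w))_{vw\in E(G)}$. An infinitesimal flex of a well-positioned $(G,p)$ is an element of $\ker df_G(p)$; it is trivial if there is a $C^1$ curve $\gamma$ in the isometry group of $X$ (all isometries of $X$ are affine) with $\gamma(0)=\mathrm{id}$ and $u_v=\frac{d}{dt}\gamma(t)(p_v)|_{t=0}$ for all $v$ (in a non-Euclidean normed plane the trivial flexes are exactly the constant families $u_v=a$, $a\in X$). A well-positioned $(G,p)$ is infinitesimally rigid if every infinitesimal flex is trivial, independent if $df_G(p)$ is surjective (frameworks with no edges count as independent), and isostatic if it is both. A graph $G$ is rigid (resp. independent, isostatic) in $X$ if some placement $p$ makes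 $(G,p)$ infinitesimally rigid (resp. independent, isostatic). *)

theory Defs
  imports "HOL-Analysis.Analysis"
begin

text \<open>Normed planes are modelled as a type 'a of class real_normed_vector whose
(real) dimension is 2. The dual space consists of the bounded linear functionals,
with the operator norm onorm.\<close>

definition support_functional :: "'a::real_normed_vector \<Rightarrow> ('a \<Rightarrow> real) \<Rightarrow> bool" where
  "support_functional x f \<longleftrightarrow> bounded_linear f \<and> onorm f = norm x \<and> f x = (norm x)^2"

definition smooth_point :: "'a::real_normed_vector \<Rightarrow> bool" where
  "smooth_point x \<longleftrightarrow> x \<noteq> 0 \<and> (\<exists>!f. support_functional x f)"

definition supp_fun :: "'a::real_normed_vector \<Rightarrow> ('a \<Rightarrow> real)" where
  "supp_fun x = (THE f. support_functional x f)"

text \<open>A graph is given by a vertex set V and a set E of edges, each edge a 2-element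
subset of V. A placement is a function p from vertices to X.\<close>

definition well_positioned :: "'v set \<Rightarrow> 'v set set \<Rightarrow> ('v \<Rightarrow> 'a::real_normed_vector) \<Rightarrow> bool" where
  "well_positioned V E p \<longleftrightarrow> (\<forall>v w. {v, w} \<in> E \<longrightarrow> v \<noteq> w \<longrightarrow> smooth_point (p v - p w))"

definition edge_functional :: "('v \<Rightarrow> 'a::real_normed_vector) \<Rightarrow> 'v \<Rightarrow> 'v \<Rightarrow> ('a \<Rightarrow> real)" where
  "edge_functional p v w = supp_fun ((1 / norm (p v - p w)) *\<^sub>R (p v - p w))"

definition inf_flex :: "'v set \<Rightarrow> 'v set set \<Rightarrow> ('v \<Rightarrow> 'a::real_normed_vector) \<Rightarrow> ('v \<Rightarrow> 'a) \<Rightarrow> bool" where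
  "inf_flex V E p u \<longleftrightarrow> (\<forall>v w. {v, w} \<in> E \<longrightarrow> v \<noteq> w \<longrightarrow> edge_functional p v w (u v - u w) = 0)"

definition isometry_map :: "('a::real_normed_vector \<Rightarrow> 'a) \<Rightarrow> bool" where
  "isometry_map g \<longleftrightarrow> bij g \<and> (\<forall>x y. dist (g x) (g y) = dist x y)"

text \<open>Trivial flexes: derivatives at 0 of a C^1 curve in the isometry group through
the identity. Since all isometries are affine, a curve of isometries is C^1 iff each
orbit map t \<mapsto> gamma t x is C^1.\<close>
definition trivial_flex :: "'v set \<Rightarrow> ('v \<Rightarrow> 'a::real_normed_vector) \<Rightarrow> ('v \<Rightarrow> 'a) \<Rightarrow> bool" where
  "trivial_flex V p u \<longleftrightarrow>
     (\<exists>(\<gamma> :: real \<Rightarrow> 'a \<Rightarrow> 'a) e. e > 0 \<and>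
        (\<forall>t \<in> {-e<..<e}. isometry_map (\<gamma> t)) \<and> \<gamma> 0 = id \<and>
        (\<forall>x. (\<lambda>t. \<gamma> t x) C1_differentiable_on {-e<..<e}) \<and>
        (\<forall>v \<in> V. u v = vector_derivative (\<lambda>t. \<gamma> t (p v)) (at 0)))"

definition inf_rigid :: "'v set \<Rightarrow> 'v set set \<Rightarrow> ('v \<Rightarrow> 'a::real_normed_vector) \<Rightarrow> bool" where
  "inf_rigid V E p \<longleftrightarrow> well_positioned V E p \<and> (\<forall>u. inf_flex V E p u \<longrightarrow> trivial_flex V p u)"

definition K_vertices :: "nat \<Rightarrow> nat set" where
  "K_vertices n = {0..<n}"

definition K_edges :: "nat \<Rightarrow> nat set set" where
  "K_edges n = {{v, w} | v w. v < n \<and> w < n \<and> v \<noteq> w}"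

end

theory Submission
  imports Defs
begin

text \<open>
  Take a unit vector \<open>y\<close> at which the norm is smooth, let \<open>x\<close> span the kernel of its support
  functional, and put \<open>N t = \<parallel>x + t y\<parallel>\<close>. This is a convex function, and \<open>x + t y\<close> is smooth at every
  continuity point \<open>t\<close> of a subgradient \<open>g\<close> of \<open>N\<close>, hence for all but countably many \<open>t\<close>. The support
  functional there is proportional to \<open>A t x\<^sup>* + g t y\<^sup>*\<close> with \<open>A t = N t - t g t\<close>.

  Place \<open>K\<^sub>4\<close> as a parallelogram with sides \<open>x + a y\<close> and \<open>x + b y\<close>: its diagonals are parallel to
  \<open>y\<close> and to \<open>x + m y\<close>, where \<open>m = (a + b) / 2\<close>. If it has a non-constant flex although the functionals
  of its sides are independent, then the slope \<open>h = g / A\<close> satisfies \<open>h m = (h a + h b) / 2\<close>. So if no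
  such placement is rigid, the monotone function \<open>h\<close> is affine. The resulting differential equation
  for \<open>N\<close>, together with \<open>N t / \<bar>t\<bar> \<longrightarrow> 1\<close> at both ends, gives \<open>(N t)\<^sup>2 = t\<^sup>2 + k\<close>. Hence the plane is
  Euclidean, and there the flexes of a rhombus come from translations and rotations.
\<close>

section \<open>Real functions\<close>

text \<open>Three consecutive multiples of \<open>r\<close> form a midpoint configuration, so the
  second differences of \<open>k\<close> along the multiples vanish. This is why the induction steps
  back by both one and two.\<close>

lemma midpoint_affine_on_nat:
  fixes k :: "rat \<Rightarrow> real"
  assumes mid: "\<And>a b. k ((a + b) / 2) = (k a + k b) / 2"
  shows "k (of_nat n * r) = k 0 + of_nat n * (k r - k 0)"
proof (induction n rule: less_induct)
  case (less n)
  consider "n = 0" | "n = 1" | m where "n = Suc (Suc m)"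
    by (metis One_nat_def nat.exhaust)
  then show ?case
  proof cases
    case 3
    have "k (of_nat (Suc m) * r) = (k (of_nat m * r) + k (of_nat n * r)) / 2"
    proof -
      have "of_nat (Suc m) * r = (of_nat m * r + of_nat n * r) / 2"
        using 3 by (simp add: algebra_simps)
      then show ?thesis by (simp only: mid)
    qed
    with less.IH[of m] less.IH[of "Suc m"] 3 show ?thesis
      by (simp add: algebra_simps)
  qed auto
qed

lemma midpoint_affine_rat:
  fixes k :: "rat \<Rightarrow> real"
  assumes mid: "\<And>a b. k ((a + b) / 2) = (k a + k b) / 2"
  shows "k q = k 0 + of_rat q * (k 1 - k 0)"
proof -
  note nat = midpoint_affine_on_nat[OF mid]
  \<comment> \<open>0 is the midpoint of \<open>r\<close> and \<open>- r\<close>, so negative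
    fractions reduce to nonnegative ones.\<close>
  have neg: "k (- r) - k 0 = - (k r - k 0)" for r
    using mid[of r "- r"] by simp
  obtain i j :: int where q: "q = of_int i / of_int j" and j: "j > 0"
    by (metis quotient_of_div quotient_of_denom_pos prod.collapse)
  define n where "n = nat j"
  have n: "n > 0" "of_int j = (of_nat n :: rat)"
    using j by (auto simp: n_def)
  have unit: "k 1 - k 0 = of_nat n * (k (1 / of_nat n) - k 0)"
    using nat[of n "1 / of_nat n"] n by simp
  obtain m where m: "i = int m \<or> i = - int m"
    by (metis int_cases2)
  have "k (of_nat m / of_nat n) - k 0 = of_nat m * (k (1 / of_nat n) - k 0)"
    using nat[of m "1 / of_nat n"] by simp
  also have "\<dots> = of_nat m / of_nat n * (k 1 - k 0)"
    using n unfolding unit by simp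
  finally have main: "k (of_nat m / of_nat n) - k 0 = of_nat m / of_nat n * (k 1 - k 0)" .
  show ?thesis
  proof (cases "i = int m")
    case True
    then show ?thesis using main by (simp add: q n of_rat_divide)
  next
    case False
    then have "q = - (of_nat m / of_nat n)"
      using m by (simp add: q n)
    then show ?thesis using main neg[of "of_nat m / of_nat n"]
      by (simp add: of_rat_divide of_rat_minus)
  qed
qed

lemma countable_vimage_real_affine:
  fixes C :: "real set"
  assumes "countable C" "a \<noteq> 0"
  shows "countable {s. a * s + b \<in> C}"
proof -
  have "{s. a * s + b \<in> C} = (\<lambda>c. (c - b) / a) ` C"
    using assms(2) by (force simp: image_iff field_simps)
  then show ?thesis using assms(1) by simp
qed

text \<open>A translate of the rationals avoids the countable exceptional set.\<close>
lemma mono_midpoint_imp_affine: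
  fixes h :: "real \<Rightarrow> real"
  assumes "mono h" and C: "countable C"
    and mid: "\<And>a b. \<lbrakk>a \<notin> C; b \<notin> C; (a + b) / 2 \<notin> C\<rbrakk> \<Longrightarrow> h ((a + b) / 2) = (h a + h b) / 2"
  obtains c d where "\<And>t. h t = c * t + d"
proof -
  have "countable (\<Union>q :: rat. {s. 1 * s + of_rat q \<in> C})"
    by (intro countable_UN countable_vimage_real_affine C) auto
  then obtain t0 where "t0 \<notin> (\<Union>q :: rat. {s. 1 * s + of_rat q \<in> C})"
    using uncountable_UNIV_real by (metis UNIV_eq_I)
  then have t0: "t0 + of_rat q \<notin> C" for q
    by simp
  define k where "k q = h (t0 + of_rat q)" for q :: rat
  have "k ((a + b) / 2) = (k a + k b) / 2" for a b
  proof -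
    have "t0 + of_rat ((a + b) / 2) = ((t0 + of_rat a) + (t0 + of_rat b)) / 2"
      by (simp add: of_rat_divide of_rat_add field_simps)
    with mid[of "t0 + of_rat a" "t0 + of_rat b"] t0 show ?thesis
      by (metis k_def)
  qed
  then have k: "k q = k 0 + of_rat q * (k 1 - k 0)" for q
    by (rule midpoint_affine_rat)
  define c where "c = k 1 - k 0"
  have "k 0 \<le> k 1"
    unfolding k_def by (rule monoD[OF \<open>mono h\<close>]) simp
  then have c: "c \<ge> 0" by (simp add: c_def)
  have "h (t0 + s) = k 0 + s * c" for s
  proof (rule ccontr)
    assume neq: "h (t0 + s) \<noteq> k 0 + s * c"
    \<comment> \<open>If \<open>s\<close> lies within \<open>e\<close> of rationals on both sides,
      monotonicity bounds the gap by \<open>e * c\<close>. With \<open>c + 1\<close> in the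
      denominator the gap is \<open>e * (c + 1)\<close>, which is strictly larger even for
      \<open>c = 0\<close>.\<close>
    define e where "e = \<bar>h (t0 + s) - (k 0 + s * c)\<bar> / (c + 1)"
    have e: "e > 0" "e * (c + 1) = \<bar>h (t0 + s) - (k 0 + s * c)\<bar>"
      using neq c by (auto simp: e_def)
    obtain q where q: "s < of_rat q" "of_rat q < s + e"
      using of_rat_dense[of s "s + e"] e by auto
    obtain r where r: "s - e < of_rat r" "of_rat r < s"
      using of_rat_dense[of "s - e" s] e by auto
    have "h (t0 + s) \<le> k q" "k r \<le> h (t0 + s)"
      unfolding k_def using q r by (auto intro: monoD[OF \<open>mono h\<close>])
    then have "h (t0 + s) \<le> k 0 + of_rat q * c" "k 0 + of_rat r * c \<le> h (t0 + s)"
      using k[of q] k[of r] by (simp_all add: c_def)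
    moreover have "of_rat q * c \<le> (s + e) * c" "(s - e) * c \<le> of_rat r * c"
      using q r c by (auto intro: mult_right_mono)
    ultimately have "\<bar>h (t0 + s) - (k 0 + s * c)\<bar> \<le> e * c"
      by (simp add: algebra_simps)
    with e show False by (simp add: algebra_simps)
  qed
  from this[of "t - t0" for t] have "h t = c * t + (k 0 - c * t0)" for t
    by (simp add: algebra_simps)
  then show thesis by (rule that)
qed

section \<open>Subgradients of convex functions on the line\<close>

lemma convex_on_subgradient:
  fixes f :: "real \<Rightarrow> real"
  assumes "convex_on UNIV f"
  obtains g where "\<And>s t. f t + g t * (s - t) \<le> f s"
proof (rule that)
  \<comment> \<open>The witness is the right derivative of \<open>f\<close> at \<open>t\<close>, as
    the infimum of the difference quotients to the right.\<close>
  show "f t + Inf ((\<lambda>s. (f t - f s) / (t - s)) ` ({t<..} \<inter> UNIV)) * (s - t) \<le> f s" for s t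
    by (rule convex_le_Inf_differential[OF assms]) auto
qed

lemma subgradient_mono:
  fixes f g :: "real \<Rightarrow> real"
  assumes "\<And>s t. f t + g t * (s - t) \<le> f s"
  shows "mono g"
proof (rule monoI)
  fix s t :: real
  assume "s \<le> t"
  have "g s * (t - s) \<le> g t * (t - s)"
    using assms[of s t] assms[of t s] by (simp add: algebra_simps)
  with \<open>s \<le> t\<close> show "g s \<le> g t"
    by (cases "s = t") auto
qed

text \<open>Any slope \<open>k\<close> of a supporting line at \<open>t\<close> lies above all
  \<open>g s\<close> with \<open>s < t\<close> and below all \<open>g s\<close> with
  \<open>s > t\<close>; continuity of \<open>g\<close> closes this gap.\<close>

lemma subgradient_unique_if_isCont:
  fixes f g :: "real \<Rightarrow> real"
  assumes sub: "\<And>s t. f t + g t * (s - t) \<le> f s"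
    and cont: "isCont g t" and k: "\<And>s. f t + k * (s - t) \<le> f s"
  shows "k = g t"
proof (rule antisym)
  have *: "k * (s - t) \<le> g s * (s - t)" for s
    using sub[of s t] k[of s] by (simp add: algebra_simps)
  have lim: "(g \<longlongrightarrow> g t) (at t)"
    using cont by (simp add: isCont_def)
  have "k \<le> g s" if "s > t" for s
    using *[of s] that by simp
  then show "k \<le> g t"
    by (intro tendsto_lowerbound[OF tendsto_within_subset[OF lim subset_UNIV, of "{t<..}"]])
       (auto simp: eventually_at_topological)
  have "g s \<le> k" if "s < t" for s
    using *[of s] that by (simp add: mult_le_cancel_right)
  then show "g t \<le> k"
    by (intro tendsto_upperbound[OF tendsto_within_subset[OF lim subset_UNIV, of "{..<t}"]])
       (auto simp: eventually_at_topological)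
qed

lemma subgradient_has_derivative_if_isCont:
  fixes f g :: "real \<Rightarrow> real"
  assumes sub: "\<And>s t. f t + g t * (s - t) \<le> f s" and cont: "isCont g t"
  shows "(f has_real_derivative g t) (at t)"
proof -
  have "((\<lambda>s. (f s - f t) / (s - t) - g t) \<longlongrightarrow> 0) (at t)"
  proof (rule Lim_null_comparison)
    show "((\<lambda>s. \<bar>g s - g t\<bar>) \<longlongrightarrow> 0) (at t)"
      using cont by (simp add: isCont_def LIM_zero_iff tendsto_rabs_zero_iff)
    \<comment> \<open>The subgradient inequalities at \<open>t\<close> and at \<open>s\<close> trap
      the difference quotient between \<open>g t\<close> and \<open>g s\<close>.\<close>
    have "\<bar>(f s - f t) / (s - t) - g t\<bar> \<le> \<bar>g s - g t\<bar>" if "s \<noteq> t" for s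
    proof -
      define q where "q = (f s - f t) / (s - t)"
      have q: "f s - f t = q * (s - t)"
        using that by (simp add: q_def)
      have "g t * (s - t) \<le> q * (s - t)" "q * (s - t) \<le> g s * (s - t)"
        using sub[of t s] sub[of s t] q by (simp_all add: algebra_simps)
      then have "g t \<le> q \<and> q \<le> g s \<or> g s \<le> q \<and> q \<le> g t"
        using that by (auto simp: mult_le_cancel_right)
      then show ?thesis unfolding q_def[symmetric] by linarith
    qed
    then show "\<forall>\<^sub>F s in at t. norm ((f s - f t) / (s - t) - g t) \<le> \<bar>g s - g t\<bar>"
      by (auto simp: eventually_at_topological)
  qed
  then show ?thesis
    by (simp add: has_field_derivative_iff LIM_zero_iff)
qed

lemma mono_constant_if_same_limits:
  fixes f :: "real \<Rightarrow> real"
  assumes "mono f" "(f \<longlongrightarrow> l) at_top" "(f \<longlongrightarrow> l) at_bot"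
  shows "f t = l"
proof (rule antisym)
  show "f t \<le> l"
    by (rule tendsto_lowerbound[OF assms(2)])
       (auto intro: monoD[OF assms(1)] eventually_mono[OF eventually_ge_at_top[of t]])
  show "l \<le> f t"
    by (rule tendsto_upperbound[OF assms(3)])
       (auto intro: monoD[OF assms(1)] eventually_mono[OF eventually_le_at_bot[of t]])
qed

section \<open>Support functionals\<close>

lemma support_functional_scale:
  assumes "support_functional z f"
  shows "support_functional (c *\<^sub>R z) (\<lambda>w. c * f w)"
proof -
  have "bounded_linear f" using assms by (simp add: support_functional_def)
  then show ?thesis
    using assms onorm_scaleR[of f c] bounded_linear_const_mult[of f c]
    by (auto simp: support_functional_def power2_eq_square linear_cmul
        bounded_linear.linear abs_mult algebra_simps)
qed

lemma support_functional_supp_fun: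
  "smooth_point z \<Longrightarrow> support_functional z (supp_fun z)"
  unfolding smooth_point_def supp_fun_def by (elim conjE theI')

lemma supp_fun_eqI:
  "\<lbrakk>smooth_point z; support_functional z f\<rbrakk> \<Longrightarrow> supp_fun z = f"
  using support_functional_supp_fun[of z] unfolding smooth_point_def by blast

lemma smooth_point_scale:
  assumes "smooth_point z" "c \<noteq> 0"
  shows "smooth_point (c *\<^sub>R z)"
proof -
  have "f = (\<lambda>w. c * supp_fun z w)" if "support_functional (c *\<^sub>R z) f" for f
  proof -
    have "support_functional z (\<lambda>w. inverse c * f w)"
      using support_functional_scale[OF that, of "inverse c"] assms(2) by simp
    then have "supp_fun z = (\<lambda>w. inverse c * f w)"
      by (rule supp_fun_eqI[OF assms(1)])
    then show ?thesis using assms(2) by (simp add: fun_eq_iff)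
  qed
  moreover have "support_functional (c *\<^sub>R z) (\<lambda>w. c * supp_fun z w)"
    by (rule support_functional_scale[OF support_functional_supp_fun[OF assms(1)]])
  ultimately show ?thesis
    using assms unfolding smooth_point_def by auto
qed

lemma supp_fun_scale:
  assumes "smooth_point z" "c \<noteq> 0"
  shows "supp_fun (c *\<^sub>R z) w = c * supp_fun z w"
  using supp_fun_eqI[OF smooth_point_scale[OF assms]
      support_functional_scale[OF support_functional_supp_fun[OF assms(1)]]] by simp

text \<open>Support functionals are homogeneous, so the flex condition of an edge depends only on
  its direction, not on its length or orientation.\<close>

lemma edge_functional_eq_0_iff:
  assumes "smooth_point z" "c \<noteq> 0" "p v - p w = c *\<^sub>R z"
  shows "edge_functional p v w u = 0 \<longleftrightarrow> supp_fun z u = 0"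
proof -
  have "z \<noteq> 0" using assms(1) by (simp add: smooth_point_def)
  then have "1 / norm (c *\<^sub>R z) * c \<noteq> 0" using assms(2) by simp
  then show ?thesis
    using supp_fun_scale[OF assms(1), of "1 / norm (c *\<^sub>R z) * c" u]
    unfolding edge_functional_def assms(3) by simp
qed

section \<open>Parallelograms\<close>

text \<open>The vertices are numbered cyclically, so that 02 and 13 are the diagonals. Indices above
  3 also get \<open>w\<close>.\<close>

definition parallelogram :: "'a \<Rightarrow> 'a \<Rightarrow> nat \<Rightarrow> 'a::real_normed_vector" where
  "parallelogram v w i = (if i = 0 then 0 else if i = 1 then v else if i = 2 then v + w else w)"

lemma parallelogram_simps [simp]:
  "parallelogram v w 0 = 0" "parallelogram v w 1 = v" "parallelogram v w (Suc 0) = v"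
  "parallelogram v w 2 = v + w" "parallelogram v w 3 = w"
  by (simp_all add: parallelogram_def)

lemma less_4_iff: "i < (4::nat) \<longleftrightarrow> i = 0 \<or> i = 1 \<or> i = 2 \<or> i = 3"
  by auto

lemma K_edges_iff: "{i, j} \<in> K_edges n \<and> i \<noteq> j \<longleftrightarrow> i < n \<and> j < n \<and> i \<noteq> j"
  unfolding K_edges_def by (auto simp: doubleton_eq_iff)

lemma well_positioned_parallelogram:
  assumes "smooth_point v" "smooth_point w" "smooth_point (v + w)" "smooth_point (v - w)"
  shows "well_positioned (K_vertices 4) (K_edges 4) (parallelogram v w)"
proof -
  have neg: "smooth_point (- z)" if "smooth_point z" for z :: 'a
    using smooth_point_scale[OF that, of "-1"] by simp
  have "smooth_point (parallelogram v w i - parallelogram v w j)"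
    if "i < 4" "j < 4" "i \<noteq> j" for i j
    using that assms neg[OF assms(1)] neg[OF assms(2)] neg[OF assms(3)] neg[OF assms(4)]
    by (auto simp: less_4_iff algebra_simps)
  then show ?thesis
    unfolding well_positioned_def using K_edges_iff by blast
qed

text \<open>Opposite sides are equal as vectors, so the six edges involve only four functionals:
  each side direction gives two equations, each diagonal one.\<close>

lemma inf_flex_parallelogramD:
  assumes "inf_flex (K_vertices 4) (K_edges 4) (parallelogram v w) u"
    and "smooth_point v" "smooth_point w" "smooth_point (v + w)" "smooth_point (v - w)"
  shows "supp_fun v (u 1 - u 0) = 0" "supp_fun v (u 2 - u 3) = 0"
    "supp_fun w (u 3 - u 0) = 0" "supp_fun w (u 2 - u 1) = 0"
    "supp_fun (v + w) (u 2 - u 0) = 0" "supp_fun (v - w) (u 1 - u 3) = 0"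
proof -
  have flex: "edge_functional (parallelogram v w) i j (u i - u j) = 0"
    if "i < 4" "j < 4" "i \<noteq> j" for i j
    using assms(1) that K_edges_iff[of i j 4] unfolding inf_flex_def by blast
  have *: "supp_fun z (u i - u j) = 0"
    if "smooth_point z" "parallelogram v w i - parallelogram v w j = z" "i < 4" "j < 4" "i \<noteq> j"
    for i j z
    using edge_functional_eq_0_iff[of z 1 "parallelogram v w" i j] flex[of i j] that by simp
  show "supp_fun v (u 1 - u 0) = 0" "supp_fun v (u 2 - u 3) = 0"
    "supp_fun w (u 3 - u 0) = 0" "supp_fun w (u 2 - u 1) = 0"
    "supp_fun (v + w) (u 2 - u 0) = 0" "supp_fun (v - w) (u 1 - u 3) = 0"
    by (rule *; use assms in simp)+
qed

lemma trivial_flex_constant: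
  assumes "\<And>i. i \<in> V \<Longrightarrow> u i = a"
  shows "trivial_flex V p u"
proof -
  define \<gamma> :: "real \<Rightarrow> 'b \<Rightarrow> 'b" where "\<gamma> t z = z + t *\<^sub>R a" for t z
  have deriv: "((\<lambda>t. \<gamma> t z) has_vector_derivative a) (at t)" for z t
    unfolding \<gamma>_def by (auto intro!: derivative_eq_intros)
  have "isometry_map (\<gamma> t)" for t
    unfolding isometry_map_def
  proof
    show "bij (\<gamma> t)"
      by (rule o_bij[of "\<lambda>z. z - t *\<^sub>R a"]) (auto simp: \<gamma>_def)
  qed (simp add: \<gamma>_def)
  moreover have "(\<lambda>t. \<gamma> t z) C1_differentiable_on {-1<..<1}" for z
    unfolding C1_differentiable_on_def using deriv by (intro exI[of _ "\<lambda>_. a"]) auto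
  moreover have "\<gamma> 0 = id" by (auto simp: \<gamma>_def)
  ultimately show ?thesis
    unfolding trivial_flex_def using assms vector_derivative_at[OF deriv]
    by (intro exI[of _ \<gamma>] exI[of _ 1]) simp
qed

section \<open>Norms in coordinates\<close>

locale plane_basis =
  fixes x y :: "'a::real_normed_vector"
  assumes spans: "\<exists>s t. z = s *\<^sub>R x + t *\<^sub>R y"
    and indep: "s *\<^sub>R x + t *\<^sub>R y = 0 \<Longrightarrow> s = 0 \<and> t = 0"
begin

lemma coords_unique:
  assumes "s *\<^sub>R x + t *\<^sub>R y = s' *\<^sub>R x + t' *\<^sub>R y"
  shows "s = s' \<and> t = t'"
  using indep[of "s - s'" "t - t'"] assms by (simp add: algebra_simps)

definition cx :: "'a \<Rightarrow> real" where
  "cx z = (THE s. \<exists>t. z = s *\<^sub>R x + t *\<^sub>R y)"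

definition cy :: "'a \<Rightarrow> real" where
  "cy z = (THE t. \<exists>s. z = s *\<^sub>R x + t *\<^sub>R y)"

lemma coords_combination: "cx (s *\<^sub>R x + t *\<^sub>R y) = s" "cy (s *\<^sub>R x + t *\<^sub>R y) = t"
  unfolding cx_def cy_def using coords_unique by blast+

lemma coords_decomposition: "z = cx z *\<^sub>R x + cy z *\<^sub>R y"
  using spans[of z] by (auto simp: coords_combination)

lemma coords_eqI: "cx z = cx w \<Longrightarrow> cy z = cy w \<Longrightarrow> z = w"
  using coords_decomposition by metis

lemma coords_add [simp]: "cx (z + w) = cx z + cx w" "cy (z + w) = cy z + cy w"
proof -
  have "z + w = (cx z + cx w) *\<^sub>R x + (cy z + cy w) *\<^sub>R y"
    by (subst coords_decomposition[of z], subst coords_decomposition[of w])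
       (simp add: algebra_simps)
  then show "cx (z + w) = cx z + cx w" "cy (z + w) = cy z + cy w"
    by (metis coords_combination)+
qed

lemma coords_scale [simp]: "cx (c *\<^sub>R z) = c * cx z" "cy (c *\<^sub>R z) = c * cy z"
proof -
  have "c *\<^sub>R z = (c * cx z) *\<^sub>R x + (c * cy z) *\<^sub>R y"
    by (subst coords_decomposition[of z]) (simp add: algebra_simps)
  then show "cx (c *\<^sub>R z) = c * cx z" "cy (c *\<^sub>R z) = c * cy z"
    by (metis coords_combination)+
qed

lemma coords_diff [simp]: "cx (z - w) = cx z - cx w" "cy (z - w) = cy z - cy w"
  using coords_add[of z "(-1) *\<^sub>R w"] coords_scale[of "-1" w] by simp_all

lemma coords_0 [simp]: "cx 0 = 0" "cy 0 = 0"
  using coords_scale[of 0 0] by simp_all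

lemma coords_basis [simp]: "cx x = 1" "cy x = 0" "cx y = 0" "cy y = 1"
  using coords_combination[of 1 0] coords_combination[of 0 1] by simp_all

text \<open>By homogeneity \<open>N\<close> and \<open>norm y\<close> together determine the norm of
  the plane.\<close>

definition N :: "real \<Rightarrow> real" where
  "N t = norm (x + t *\<^sub>R y)"

lemma N_pos: "N t > 0"
  using indep[of 1 t] by (auto simp: N_def)

lemma norm_combination: "norm (s *\<^sub>R x + t *\<^sub>R y) = \<bar>s\<bar> * N (t / s)" if "s \<noteq> 0"
proof -
  have "s *\<^sub>R x + t *\<^sub>R y = s *\<^sub>R (x + (t / s) *\<^sub>R y)"
    using that by (simp add: algebra_simps)
  then show ?thesis by (simp add: N_def)
qed

lemma N_lipschitz: "N s \<le> N t + \<bar>s - t\<bar> * norm y"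
proof -
  have "x + s *\<^sub>R y = (x + t *\<^sub>R y) + (s - t) *\<^sub>R y" by (simp add: algebra_simps)
  then show ?thesis unfolding N_def by (metis norm_triangle_ineq norm_scaleR)
qed

lemma convex_N: "convex_on UNIV N"
proof (rule convex_onI)
  fix u s t :: real
  assume u: "0 < u" "u < 1"
  have "x + ((1 - u) *\<^sub>R s + u *\<^sub>R t) *\<^sub>R y = (1 - u) *\<^sub>R (x + s *\<^sub>R y) + u *\<^sub>R (x + t *\<^sub>R y)"
    by (simp add: algebra_simps)
  then show "N ((1 - u) *\<^sub>R s + u *\<^sub>R t) \<le> (1 - u) * N s + u * N t"
    unfolding N_def using u
      norm_triangle_ineq[of "(1 - u) *\<^sub>R (x + s *\<^sub>R y)" "u *\<^sub>R (x + t *\<^sub>R y)"] by simp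
qed simp

lemma isCont_N: "isCont N t"
  unfolding N_def by (intro continuous_intros)

lemma N_growth: "((\<lambda>t. N t / \<bar>t\<bar>) \<longlongrightarrow> norm y) at_infinity"
proof (rule Lim_transform_eventually)
  have "((\<lambda>t. norm (inverse t *\<^sub>R x + y)) \<longlongrightarrow> norm (0 *\<^sub>R x + y)) at_infinity"
    by (intro tendsto_intros tendsto_inverse_0)
  then show "((\<lambda>t. norm (inverse t *\<^sub>R x + y)) \<longlongrightarrow> norm y) at_infinity" by simp
  have "norm (inverse t *\<^sub>R x + y) = N t / \<bar>t\<bar>" if "t \<noteq> 0" for t
  proof -
    have "inverse t *\<^sub>R x + y = inverse t *\<^sub>R (x + t *\<^sub>R y)"
      using that by (simp add: algebra_simps)
    then show ?thesis by (simp add: N_def divide_inverse mult.commute)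
  qed
  then show "\<forall>\<^sub>F t in at_infinity. norm (inverse t *\<^sub>R x + y) = N t / \<bar>t\<bar>"
    unfolding eventually_at_infinity by (intro exI[of _ 1]) auto
qed

lemma subgradient_bound:
  assumes "\<And>s. N t + k * (s - t) \<le> N s"
  shows "\<bar>k\<bar> \<le> norm y"
  using assms[of "t + 1"] assms[of "t - 1"] N_lipschitz[of "t + 1" t] N_lipschitz[of "t - 1" t]
  by simp

text \<open>The linear functional whose value at \<open>x + s y\<close> is
  \<open>N t + k * (s - t)\<close>, that is, the extension to the plane of the line of slope
  \<open>k\<close> through the graph point of \<open>N\<close> at \<open>t\<close>.\<close>

definition tangent :: "real \<Rightarrow> real \<Rightarrow> 'a \<Rightarrow> real" where
  "tangent t k z = (N t - t * k) * cx z + k * cy z"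

text \<open>On \<open>x + s y\<close> this is the assumption on \<open>k\<close>, and homogeneity
  extends it to positive multiples. Multiples of \<open>y\<close> and negative multiples need
  \<open>\<bar>k\<bar> \<le> norm y\<close>.\<close>

lemma tangent_le_norm:
  assumes k: "\<And>s. N t + k * (s - t) \<le> N s"
  shows "tangent t k z \<le> norm z"
proof -
  obtain s r where z: "z = s *\<^sub>R x + r *\<^sub>R y" using spans by blast
  have tan: "tangent t k z = (N t - t * k) * s + k * r"
    by (simp add: tangent_def z)
  have bound: "k * a \<le> \<bar>a\<bar> * norm y" for a
  proof -
    have "k * a \<le> \<bar>k\<bar> * \<bar>a\<bar>" by (metis abs_ge_self abs_mult)
    also have "\<dots> \<le> norm y * \<bar>a\<bar>"
      by (intro mult_right_mono subgradient_bound[OF k]) auto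
    finally show ?thesis by (simp add: mult.commute)
  qed
  show ?thesis
  proof (cases "s = 0")
    case True
    then show ?thesis using bound[of r] by (simp add: tan) (simp add: z)
  next
    case False
    have eq: "tangent t k z = s * (N t + k * (r / s - t))"
      using False by (simp add: tan field_simps)
    have nz: "norm z = \<bar>s\<bar> * N (r / s)"
      using norm_combination[OF False] by (simp add: z)
    \<comment> \<open>This covers \<open>s < 0\<close>: the points at \<open>r / s\<close> and
      \<open>t\<close> differ by \<open>(r / s - t) y\<close>, whose norm is at most
      \<open>N (r / s) + N t\<close>.\<close>
    have "- (N t + k * (r / s - t)) \<le> N (r / s)"
    proof -
      have "\<bar>r / s - t\<bar> * norm y = norm ((x + (r / s) *\<^sub>R y) - (x + t *\<^sub>R y))"
        by (simp add: scaleR_diff_left[symmetric])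
      also have "\<dots> \<le> N (r / s) + N t"
        unfolding N_def by (rule norm_triangle_ineq4)
      finally show ?thesis 
        using bound[of "- (r / s - t)", unfolded abs_minus_cancel mult_minus_right] by linarith
    qed
    then have "\<bar>N t + k * (r / s - t)\<bar> \<le> N (r / s)"
      using k[of "r / s"] by (simp only: abs_le_iff)
    then have "\<bar>s * (N t + k * (r / s - t))\<bar> \<le> \<bar>s\<bar> * N (r / s)"
      unfolding abs_mult by (intro mult_left_mono) auto
    then show ?thesis by (simp add: eq nz)
  qed
qed

text \<open>\<open>tangent t k\<close> has norm 1 and attains it at \<open>x + t y\<close>; the
  factor \<open>N t\<close> gives the normalisation of support functionals.\<close>

lemma support_functional_tangent:
  assumes k: "\<And>s. N t + k * (s - t) \<le> N s"
  shows "support_functional (x + t *\<^sub>R y) (\<lambda>z. N t * tangent t k z)"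
proof -
  let ?f = "\<lambda>z. N t * tangent t k z"
  have neg: "tangent t k (- z) = - tangent t k z" for z
    using coords_scale[of "-1" z] by (simp add: tangent_def)
  have abs: "\<bar>tangent t k z\<bar> \<le> norm z" for z
    using tangent_le_norm[OF k, of z] tangent_le_norm[OF k, of "- z"] neg[of z] by simp
  have bound: "norm (?f z) \<le> N t * norm z" for z
    using abs[of z] N_pos[of t] by (simp add: abs_mult)
  have bl: "bounded_linear ?f"
  proof (rule bounded_linear_intro)
    show "norm (?f z) \<le> norm z * N t" for z
      using bound[of z] by (simp add: mult.commute)
  qed (simp_all add: tangent_def algebra_simps)
  have val: "?f (x + t *\<^sub>R y) = (N t)\<^sup>2"
    by (simp add: tangent_def power2_eq_square algebra_simps)
  have "N t * N t \<le> onorm ?f * N t"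
    using onorm[OF bl, of "x + t *\<^sub>R y"] val by (simp add: N_def[symmetric] power2_eq_square)
  then have "N t \<le> onorm ?f" using N_pos[of t] by simp
  moreover have "onorm ?f \<le> N t"
    using N_pos[of t] bound by (intro onorm_bound) auto
  ultimately show ?thesis
    using bl val by (simp add: support_functional_def N_def[symmetric])
qed

end

section \<open>Smooth points on the line \<open>x + t y\<close>\<close>

locale plane_subgradient = plane_basis +
  fixes g :: "real \<Rightarrow> real"
  assumes sub: "N t + g t * (s - t) \<le> N s"
begin

lemma mono_g: "mono g"
  by (rule subgradient_mono[OF sub])

lemma countable_discont: "countable {t. \<not> isCont g t}"
  by (rule mono_ctble_discont[OF mono_g])

text \<open>A support functional \<open>f\<close> at \<open>x + t y\<close> yields the subgradient
  \<open>f y / N t\<close> of \<open>N\<close>. Its uniqueness fixes \<open>f y\<close>, and then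
  the value at \<open>x + t y\<close> fixes \<open>f x\<close>.\<close>

lemma smooth_point_if_isCont:
  assumes "isCont g t"
  shows "smooth_point (x + t *\<^sub>R y)"
proof -
  have "f = (\<lambda>z. N t * tangent t (g t) z)" if f: "support_functional (x + t *\<^sub>R y) f" for f
  proof -
    have bl: "bounded_linear f" and "onorm f = N t" and val: "f (x + t *\<^sub>R y) = (N t)\<^sup>2"
      using f by (auto simp: support_functional_def N_def)
    interpret f: bounded_linear f by fact
    have le: "f z \<le> N t * norm z" for z
      using onorm[OF bl, of z] \<open>onorm f = N t\<close> by simp
    have "N t + f y / N t * (s - t) \<le> N s" for s
    proof -
      have "x + s *\<^sub>R y = (x + t *\<^sub>R y) + (s - t) *\<^sub>R y" by (simp add: algebra_simps)
      then have "f (x + s *\<^sub>R y) = (N t)\<^sup>2 + (s - t) * f y"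
        using val by (metis f.add f.scaleR real_scaleR_def)
      then have "(N t)\<^sup>2 + (s - t) * f y \<le> N t * N s"
        using le[of "x + s *\<^sub>R y"] by (simp add: N_def)
      then show ?thesis
        using N_pos[of t] by (simp add: field_simps power2_eq_square)
    qed
    then have "f y / N t = g t"
      by (rule subgradient_unique_if_isCont[OF sub assms])
    then have fy: "f y = N t * g t"
      using N_pos[of t] by (simp add: field_simps)
    have fx: "f x = N t * (N t - t * g t)"
      using val by (simp add: f.add f.scaleR fy power2_eq_square algebra_simps)
    show ?thesis
    proof
      fix z
      have "f z = cx z * f x + cy z * f y"
        by (subst coords_decomposition[of z]) (simp add: f.add f.scaleR)
      then show "f z = N t * tangent t (g t) z"
        by (simp add: fx fy tangent_def algebra_simps)
    qed
  qed
  moreover have "x + t *\<^sub>R y \<noteq> 0" using N_pos[of t] by (auto simp: N_def)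
  ultimately show ?thesis
    using support_functional_tangent[OF sub, of t] unfolding smooth_point_def by blast
qed

lemma supp_fun_eq_0_iff:
  assumes "isCont g t"
  shows "supp_fun (x + t *\<^sub>R y) z = 0 \<longleftrightarrow> tangent t (g t) z = 0"
  using supp_fun_eqI[OF smooth_point_if_isCont[OF assms] support_functional_tangent[OF sub]]
    N_pos[of t] by simp

lemma ex_isCont_g: "\<exists>t. isCont g t"
  using countable_discont uncountable_UNIV_real by (metis UNIV_eq_I mem_Collect_eq)

end

lemma (in plane_basis) ex_smooth_point: "\<exists>t. smooth_point (x + t *\<^sub>R y)"
proof -
  obtain g where "\<And>s t. N t + g t * (s - t) \<le> N s"
    using convex_on_subgradient[OF convex_N] by blast
  then interpret plane_subgradient x y g by unfold_locales
  show ?thesis using ex_isCont_g smooth_point_if_isCont by blast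
qed

section \<open>Flexes of parallelograms with one diagonal parallel to y\<close>

text \<open>With \<open>x\<close> in the kernel of the support functional of the unit vector
  \<open>y\<close>, that functional is just \<open>cy\<close>. A bar parallel to \<open>y\<close>
  then forces equal \<open>cy\<close> velocities at its two ends.\<close>

locale plane_conjugate = plane_subgradient +
  assumes smooth_y: "smooth_point y" and norm_y: "norm y = 1" and supp_y_x: "supp_fun y x = 0"
begin

text \<open>The value at 0 of the tangent line to \<open>N\<close> at \<open>t\<close>;
  equivalently, the coefficient of \<open>cx\<close> in \<open>tangent t (g t)\<close>, where
  \<open>g t\<close> is that of \<open>cy\<close>.\<close>

definition A :: "real \<Rightarrow> real" where
  "A t = N t - t * g t"

lemma supp_fun_y: "supp_fun y z = cy z"
proof -
  have "support_functional y (supp_fun y)"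
    by (rule support_functional_supp_fun[OF smooth_y])
  then have bl: "bounded_linear (supp_fun y)" and "supp_fun y y = 1"
    by (auto simp: support_functional_def norm_y)
  interpret f: bounded_linear "supp_fun y" by fact
  show ?thesis
    by (subst coords_decomposition[of z]) (simp add: f.add f.scaleR supp_y_x \<open>supp_fun y y = 1\<close>)
qed

lemma abs_cy_le_norm: "\<bar>cy z\<bar> \<le> norm z"
proof -
  have "support_functional y (supp_fun y)"
    by (rule support_functional_supp_fun[OF smooth_y])
  then show ?thesis
    using onorm[of "supp_fun y" z] by (simp add: support_functional_def norm_y supp_fun_y)
qed

lemma abs_le_N: "\<bar>t\<bar> \<le> N t"
  using abs_cy_le_norm[of "x + t *\<^sub>R y"] by (simp add: N_def)

lemma abs_g_le_1: "\<bar>g t\<bar> \<le> 1"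
  using subgradient_bound[OF sub] norm_y by simp

lemma mult_g_le_abs: "t * g t \<le> \<bar>t\<bar>"
proof -
  have "t * g t \<le> \<bar>t\<bar> * \<bar>g t\<bar>" by (metis abs_ge_self abs_mult)
  also have "\<dots> \<le> \<bar>t\<bar> * 1" by (intro mult_left_mono abs_g_le_1) simp
  finally show ?thesis by simp
qed

lemma A_pos: "N t > \<bar>t\<bar> \<Longrightarrow> A t > 0"
  using mult_g_le_abs[of t] by (simp add: A_def)

abbreviation P :: "real \<Rightarrow> real \<Rightarrow> nat \<Rightarrow> 'a" where
  "P a b \<equiv> parallelogram (x + a *\<^sub>R y) (x + b *\<^sub>R y)"

context
  fixes a b m :: real
  assumes ab: "a \<noteq> b" and m: "m = (a + b) / 2"
    and cont: "isCont g a" "isCont g b" "isCont g m"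
begin

lemma diagonals:
  "(x + a *\<^sub>R y) + (x + b *\<^sub>R y) = 2 *\<^sub>R (x + m *\<^sub>R y)"
  "(x + a *\<^sub>R y) - (x + b *\<^sub>R y) = (a - b) *\<^sub>R y"
proof -
  have "a + b = 2 * m" using m by simp
  then have "a *\<^sub>R y + b *\<^sub>R y = (2 * m) *\<^sub>R y"
    by (metis scaleR_add_left)
  then show "(x + a *\<^sub>R y) + (x + b *\<^sub>R y) = 2 *\<^sub>R (x + m *\<^sub>R y)"
    by (simp add: algebra_simps scaleR_2)
qed (simp add: algebra_simps)

lemma smooth_P:
  "smooth_point (x + a *\<^sub>R y)" "smooth_point (x + b *\<^sub>R y)"
  "smooth_point ((x + a *\<^sub>R y) + (x + b *\<^sub>R y))"
  "smooth_point ((x + a *\<^sub>R y) - (x + b *\<^sub>R y))"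
  unfolding diagonals using ab cont
  by (auto intro!: smooth_point_scale smooth_point_if_isCont smooth_y)

lemma well_positioned_P: "well_positioned (K_vertices 4) (K_edges 4) (P a b)"
  by (rule well_positioned_parallelogram[OF smooth_P])

lemma inf_flex_PD:
  assumes "inf_flex (K_vertices 4) (K_edges 4) (P a b) u"
  shows "A a * cx (u 1 - u 0) + g a * cy (u 1 - u 0) = 0"
    "A a * cx (u 2 - u 3) + g a * cy (u 2 - u 3) = 0"
    "A b * cx (u 3 - u 0) + g b * cy (u 3 - u 0) = 0"
    "A b * cx (u 2 - u 1) + g b * cy (u 2 - u 1) = 0"
    "A m * cx (u 2 - u 0) + g m * cy (u 2 - u 0) = 0"
    "cy (u 1 - u 3) = 0"
proof -
  have supp: "A t * cx z + g t * cy z = 0" if "isCont g t" "supp_fun (x + t *\<^sub>R y) z = 0" for t z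
    using supp_fun_eq_0_iff[OF that(1)] that(2) by (simp only: tangent_def A_def)
  note flex = inf_flex_parallelogramD[OF assms smooth_P]
  show "A a * cx (u 1 - u 0) + g a * cy (u 1 - u 0) = 0"
    "A a * cx (u 2 - u 3) + g a * cy (u 2 - u 3) = 0"
    "A b * cx (u 3 - u 0) + g b * cy (u 3 - u 0) = 0"
    "A b * cx (u 2 - u 1) + g b * cy (u 2 - u 1) = 0"
    by (rule supp[OF cont(1) flex(1)] supp[OF cont(1) flex(2)]
        supp[OF cont(2) flex(3)] supp[OF cont(2) flex(4)])+
  have "supp_fun (x + m *\<^sub>R y) (u 2 - u 0) = 0"
    using flex(5) supp_fun_scale[OF smooth_point_if_isCont[OF cont(3)], of 2]
    unfolding diagonals by simp
  then show "A m * cx (u 2 - u 0) + g m * cy (u 2 - u 0) = 0"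
    by (rule supp[OF cont(3)])
  show "cy (u 1 - u 3) = 0"
    using flex(6) supp_fun_scale[OF smooth_y, of "a - b"] ab
    unfolding diagonals supp_fun_y by simp
qed

text \<open>The defect \<open>?d\<close> is annihilated by the functionals of both side directions,
  because opposite sides share a functional; by \<open>det\<close> these two are
  independent.\<close>

lemma inf_flex_P_parallelogram:
  assumes "inf_flex (K_vertices 4) (K_edges 4) (P a b) u" and det: "A a * g b \<noteq> A b * g a"
  shows "u 2 - u 0 = (u 1 - u 0) + (u 3 - u 0)"
proof -
  let ?d = "u 2 - u 1 - u 3 + u 0"
  note flex = inf_flex_PD[OF assms(1)]
  have e: "A a * cx ?d + g a * cy ?d = 0" "A b * cx ?d + g b * cy ?d = 0"
    using flex(1-4) by (simp_all add: algebra_simps)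
  \<comment> \<open>Cramer's rule for the two equations \<open>e\<close>.\<close>
  have "(A a * g b - A b * g a) * cx ?d = g b * (A a * cx ?d + g a * cy ?d) - g a * (A b * cx ?d + g b * cy ?d)"
    "(A a * g b - A b * g a) * cy ?d = A a * (A b * cx ?d + g b * cy ?d) - A b * (A a * cx ?d + g a * cy ?d)"
    by (simp_all add: algebra_simps del: coords_add coords_diff)
  then have "cx ?d = 0" "cy ?d = 0" using det unfolding e by auto
  then have "?d = 0" by (intro coords_eqI) (simp_all del: coords_add coords_diff)
  then show ?thesis by (simp add: algebra_simps)
qed

text \<open>Modulo constants a flex is given by \<open>p1\<close>, \<open>q\<close> and
  \<open>p3\<close>, subject to three homogeneous linear equations. Up to sign, the difference of
  the two sides of \<open>mid\<close> is their determinant.\<close>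

lemma inf_rigid_P:
  assumes det: "A a * g b \<noteq> A b * g a"
    and mid: "2 * A a * A b * g m \<noteq> A m * (A b * g a + A a * g b)"
  shows "inf_rigid (K_vertices 4) (K_edges 4) (P a b)"
  unfolding inf_rigid_def
proof (intro conjI allI impI well_positioned_P)
  fix u
  assume flex: "inf_flex (K_vertices 4) (K_edges 4) (P a b) u"
  define p1 q p3 where "p1 = cx (u 1 - u 0)" and "q = cy (u 1 - u 0)" and "p3 = cx (u 3 - u 0)"
  have q: "cy (u 3 - u 0) = q"
    using inf_flex_PD(6)[OF flex] by (simp add: q_def)
  have e1: "A a * p1 + g a * q = 0" and e3: "A b * p3 + g b * q = 0"
    using inf_flex_PD(1,3)[OF flex] unfolding q by (simp_all only: p1_def q_def p3_def)
  have para: "u 2 - u 0 = (u 1 - u 0) + (u 3 - u 0)"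
    by (rule inf_flex_P_parallelogram[OF flex det])
  have e2: "A m * (p1 + p3) + g m * (2 * q) = 0"
    using inf_flex_PD(5)[OF flex] unfolding para coords_add q by (simp add: p1_def p3_def q_def)
  have "(2 * A a * A b * g m - A m * (A b * g a + A a * g b)) * q
      = A a * A b * (A m * (p1 + p3) + g m * (2 * q))
        - A m * (A b * (A a * p1 + g a * q) + A a * (A b * p3 + g b * q))"
    by (simp add: algebra_simps)
  then have q0: "q = 0" using mid unfolding e1 e2 e3 by simp
  \<comment> \<open>\<open>mid\<close> allows at most one of \<open>A a\<close>, \<open>A b\<close>,
    \<open>A m\<close> to vanish, so the equations still determine both unknowns.\<close>
  have "p1 = 0 \<and> p3 = 0"
    using e1 e2 e3 mid q0 by (cases "A a = 0"; cases "A b = 0"; cases "A m = 0") auto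
  then have "u 1 - u 0 = 0" "u 3 - u 0 = 0"
    using q q0 by (auto intro!: coords_eqI simp: p1_def p3_def q_def)
  with para have "u i = u 0" if "i \<in> K_vertices 4" for i
    using that by (auto simp: K_vertices_def less_4_iff)
  then show "trivial_flex (K_vertices 4) (P a b) u"
    by (rule trivial_flex_constant)
qed

end

section \<open>Non-rigidity forces the norm to be Euclidean\<close>

text \<open>With \<open>t\<close> the nearest point to 0 where \<open>N t = \<bar>t\<bar>\<close>, take \<open>b\<close> just beyond \<open>t\<close> but \<open>a\<close> and \<open>m\<close>
  before it: then the functional at \<open>b\<close> is that of \<open>y\<close> up to sign, while those at \<open>a\<close> and \<open>m\<close> are not.\<close>
lemma ex_rigid_if_flat:
  assumes "N t1 = \<bar>t1\<bar>"
  shows "\<exists>p :: nat \<Rightarrow> 'a. inf_rigid (K_vertices 4) (K_edges 4) p"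
proof -
  have "closed {t. N t = \<bar>t\<bar>}"
    using isCont_N by (intro closed_Collect_eq continuous_at_imp_continuous_on continuous_intros) auto
  then obtain t where t: "N t = \<bar>t\<bar>" and min: "\<And>s. N s = \<bar>s\<bar> \<Longrightarrow> \<bar>t\<bar> \<le> \<bar>s\<bar>"
    using distance_attains_inf[of "{t. N t = \<bar>t\<bar>}" 0] assms by auto
  have t0: "t \<noteq> 0" using t N_pos[of t] by auto
  let ?C = "{t. \<not> isCont g t}"
  \<comment> \<open>The three sets list the \<open>e\<close> for which \<open>b\<close>,
    \<open>m\<close> or \<open>a\<close>, respectively, is a discontinuity of
    \<open>g\<close>.\<close>
  have "countable ({e. t * e + t \<in> ?C} \<union> {e. (- t) * e + t \<in> ?C} \<union> {e. (- 3 * t) * e + t \<in> ?C})"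
    using t0 by (intro countable_Un countable_vimage_real_affine countable_discont) auto
  then obtain e where e: "0 < e" "e < 1 / 3"
    and econt: "isCont g (t * e + t)" "isCont g ((- t) * e + t)" "isCont g ((- 3 * t) * e + t)"
    using uncountable_open_interval[of 0 "1 / 3 :: real"] countable_subset
    by (smt (verit) Un_iff greaterThanLessThan_iff mem_Collect_eq subsetI zero_less_divide_1_iff)
  define a b m where "a = (1 - 3 * e) * t" and "b = (1 + e) * t" and "m = (1 - e) * t"
  have cont: "isCont g a" "isCont g b" "isCont g m"
    using econt by (simp_all add: a_def b_def m_def algebra_simps)
  have "\<bar>a\<bar> < \<bar>t\<bar>" "\<bar>m\<bar> < \<bar>t\<bar>"
    using e t0 by (simp_all add: a_def m_def abs_mult)
  then have "N a > \<bar>a\<bar>" "N m > \<bar>m\<bar>"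
    using min[of a] min[of m] abs_le_N[of a] abs_le_N[of m] by fastforce+
  then have A: "A a > 0" "A m > 0" using A_pos by auto
  have absb: "\<bar>b\<bar> = \<bar>t\<bar> + e * \<bar>t\<bar>"
  proof -
    have "\<bar>b\<bar> = (1 + e) * \<bar>t\<bar>" using e by (simp add: b_def abs_mult)
    then show ?thesis by (simp add: algebra_simps)
  qed
  have "N b \<le> \<bar>t\<bar> + e * \<bar>t\<bar>"
  proof -
    have "\<bar>b - t\<bar> = e * \<bar>t\<bar>" using e by (simp add: b_def algebra_simps abs_mult)
    then show ?thesis using N_lipschitz[of b t] t by (simp add: norm_y)
  qed
  then have Nb: "N b = \<bar>b\<bar>" using absb abs_le_N[of b] by simp
  \<comment> \<open>Between \<open>b\<close> and \<open>t\<close> the function \<open>N\<close>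
    drops at the maximal rate 1, so the subgradient at \<open>b\<close> has full slope. The tangent
    line at \<open>b\<close> thus passes through the origin, which is
    \<open>A b = 0\<close>.\<close>
  have "t - b = - e * t" by (simp add: b_def algebra_simps)
  then have "e * \<bar>t\<bar> \<le> e * (t * g b)"
    using sub[of b t] unfolding \<open>t - b = - e * t\<close> by (simp add: Nb absb t ac_simps)
  then have "\<bar>t\<bar> \<le> t * g b" using e by simp
  then have "(1 + e) * \<bar>t\<bar> \<le> (1 + e) * (t * g b)"
    using e by (intro mult_left_mono) auto
  moreover have "b * g b = (1 + e) * (t * g b)" by (simp add: b_def)
  ultimately have "\<bar>b\<bar> \<le> b * g b"
    unfolding absb by (simp add: distrib_right)
  then have Ab: "A b = 0" and "b * g b = \<bar>b\<bar>"
    using mult_g_le_abs[of b] by (simp_all add: A_def Nb)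
  then have gb: "g b \<noteq> 0" using t0 e by (auto simp: b_def)
  have "inf_rigid (K_vertices 4) (K_edges 4) (P a b)"
  proof (rule inf_rigid_P)
    show "a \<noteq> b" "m = (a + b) / 2"
      using t0 e by (auto simp: a_def b_def m_def algebra_simps)
  qed (use cont A Ab gb in auto)
  then show ?thesis by blast
qed

lemma A_pos_if_not_rigid:
  assumes "\<nexists>p :: nat \<Rightarrow> 'a. inf_rigid (K_vertices 4) (K_edges 4) p"
  shows "A t > 0"
proof (rule A_pos)
  have "N t \<noteq> \<bar>t\<bar>" using assms ex_rigid_if_flat by blast
  then show "\<bar>t\<bar> < N t" using abs_le_N[of t] by linarith
qed

text \<open>The coefficient vector \<open>(A t, g t)\<close> of the support functional turns
  monotonically with \<open>t\<close>. The cases fix the sign by which a subgradient inequality is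
  multiplied.\<close>

lemma slope_mono:
  assumes "A s > 0" "A t > 0" "s < t"
  shows "g s / A s \<le> g t / A t"
proof -
  have gst: "g s \<le> g t" using monoD[OF mono_g] assms(3) by simp
  have "g s * A t \<le> g t * A s"
  proof -
    consider "g s \<ge> 0" | "g t \<le> 0" | "g s \<le> 0" "g t \<ge> 0" by linarith
    then show ?thesis
    proof cases
      case 1
      have "g s * N t \<le> g s * (N s + g t * (t - s))"
        using sub[of t s] 1 by (intro mult_left_mono) (auto simp: algebra_simps)
      moreover have "g s * N s \<le> g t * N s"
        using gst N_pos[of s] by (intro mult_right_mono) auto
      ultimately show ?thesis by (simp add: A_def algebra_simps)
    next
      case 2
      have "g t * (N t + g s * (s - t)) \<le> g t * N s"
        using sub[of s t] 2 by (intro mult_left_mono_neg) (auto simp: algebra_simps)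
      moreover have "g s * N t \<le> g t * N t"
        using gst N_pos[of t] by (intro mult_right_mono) auto
      ultimately show ?thesis by (simp add: A_def algebra_simps)
    next
      case 3
      then have "g s * A t \<le> 0" "0 \<le> g t * A s"
        using assms by (auto simp: mult_nonpos_nonneg)
      then show ?thesis by linarith
    qed
  qed
  then show ?thesis using assms by (simp add: field_simps)
qed

lemma affine_slope_if_not_rigid:
  assumes "\<nexists>p :: nat \<Rightarrow> 'a. inf_rigid (K_vertices 4) (K_edges 4) p"
  obtains c d where "\<And>t. g t / A t = c * t + d"
proof -
  note A = A_pos_if_not_rigid[OF assms]
  define h where "h t = g t / A t" for t
  have "mono h"
    using slope_mono A unfolding h_def by (intro monoI) (metis order_le_less)
  have mid: "h ((a + b) / 2) = (h a + h b) / 2"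
    if "a \<notin> {t. \<not> isCont g t}" "b \<notin> {t. \<not> isCont g t}" "(a + b) / 2 \<notin> {t. \<not> isCont g t}" for a b
  proof (cases "h a = h b")
    case True
    \<comment> \<open>Here the side functionals are dependent and \<open>inf_rigid_P\<close> does
      not apply, but the monotone \<open>h\<close> is constant between \<open>a\<close> and
      \<open>b\<close>.\<close>
    have "h ((a + b) / 2) \<ge> min (h a) (h b)" "h ((a + b) / 2) \<le> max (h a) (h b)"
      using monoD[OF \<open>mono h\<close>, of a "(a + b) / 2"] monoD[OF \<open>mono h\<close>, of b "(a + b) / 2"]
        monoD[OF \<open>mono h\<close>, of "(a + b) / 2" a] monoD[OF \<open>mono h\<close>, of "(a + b) / 2" b]
      by (cases "a \<le> b"; simp)+
    then show ?thesis using True by simp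
  next
    case False
    let ?m = "(a + b) / 2"
    have g: "g t = h t * A t" for t using A[of t] by (simp add: h_def)
    have "A a * g b \<noteq> A b * g a"
      using False A[of a] A[of b] by (simp add: g)
    then have "2 * A a * A b * g ?m = A ?m * (A b * g a + A a * g b)"
      using inf_rigid_P[of a b ?m] assms that False by auto
    then have eq: "2 * A a * A b * (h ?m * A ?m) = A ?m * (A b * (h a * A a) + A a * (h b * A b))"
      by (simp only: g)
    have "(A a * A b * A ?m) * (2 * h ?m) = 2 * A a * A b * (h ?m * A ?m)"
      by (simp only: ac_simps)
    also have "\<dots> = (A a * A b * A ?m) * (h a + h b)"
      unfolding eq by (simp only: distrib_left distrib_right ac_simps)
    finally have "(A a * A b * A ?m) * (2 * h ?m) = (A a * A b * A ?m) * (h a + h b)" .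
    moreover have "A a * A b * A ?m \<noteq> 0" using A[of a] A[of b] A[of ?m] by simp
    ultimately have "2 * h ?m = h a + h b" by (metis mult_left_cancel)
    then show ?thesis by simp
  qed
  show thesis
  proof (rule mono_midpoint_imp_affine[OF \<open>mono h\<close> countable_discont])
    fix c d
    assume "\<And>t. h t = c * t + d"
    then show thesis using that[of c d] by (simp only: h_def)
  qed (rule mid)
qed

text \<open>The differential equation for N has the solutions
  \<open>N\<^sup>2 = Q \<cdot> exp (\<integral> d / Q)\<close> with \<open>Q t = 1 + d t + c t\<^sup>2\<close>; the equal growth of N at both ends
  excludes \<open>d \<noteq> 0\<close>.\<close>
lemma euclidean_if_affine_slope:
  assumes h: "\<And>t. g t / A t = c * t + d" and A: "\<And>t. A t > 0"
  obtains k where "k > 0" "\<And>t. (N t)\<^sup>2 = t\<^sup>2 + k" "\<And>t. N t * g t = t" "\<And>t. isCont g t"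
proof -
  \<comment> \<open>\<open>Q\<close> is \<open>N / A\<close>, because
    \<open>N t = A t + t * g t\<close> and \<open>g t / A t\<close> is affine.\<close>
  define Q where "Q t = 1 + d * t + c * t\<^sup>2" for t
  have gA: "g t = (c * t + d) * A t" for t
    using h[of t] A[of t] by (simp add: field_simps)
  have NQ: "N t = Q t * A t" for t
  proof -
    have "N t = A t + t * g t" by (simp add: A_def)
    then show ?thesis by (simp add: gA Q_def power2_eq_square algebra_simps)
  qed
  have Q: "Q t > 0" for t
    using N_pos[of t] A[of t] by (simp add: NQ zero_less_mult_iff)
  have g: "g t = (c * t + d) * N t / Q t" for t
    using Q[of t] by (simp add: gA NQ)
  have contQ: "isCont Q t" for t
    unfolding Q_def by (intro continuous_intros)
  have "isCont (\<lambda>t. (c * t + d) * N t / Q t) t" for t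
    using Q[of t] by (intro continuous_intros isCont_N contQ) auto
  then have contg: "isCont g t" for t
    by (simp add: g[abs_def])
  have dN: "(N has_real_derivative g t) (at t)" for t
    by (rule subgradient_has_derivative_if_isCont[OF sub contg])
  have dQ: "(Q has_real_derivative d + 2 * c * t) (at t)" for t
    unfolding Q_def by (auto intro!: derivative_eq_intros)
  \<comment> \<open>The derivative of \<open>M\<close> is \<open>d\<close> times a square, so
    \<open>M\<close> is monotone, in a direction given by the sign of \<open>d\<close>.\<close>
  define M where "M t = (N t)\<^sup>2 / Q t" for t
  have dM: "(M has_real_derivative d * ((N t)\<^sup>2 / (Q t)\<^sup>2)) (at t)" for t
  proof -
    have "((\<lambda>t. (N t)\<^sup>2 / Q t) has_real_derivative
        (2 * N t * g t * Q t - (N t)\<^sup>2 * (d + 2 * c * t)) / (Q t * Q t)) (at t)"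
      using Q[of t] by (auto intro!: derivative_eq_intros dN dQ simp: power2_eq_square)
    moreover have "2 * N t * g t * Q t = 2 * (N t)\<^sup>2 * (c * t + d)"
      using Q[of t] by (simp add: g power2_eq_square)
    ultimately show ?thesis
      by (simp add: M_def[abs_def] power2_eq_square algebra_simps)
  qed
  \<comment> \<open>Positivity of \<open>Q\<close> excludes \<open>c < 0\<close>, and also
    \<open>c = 0\<close> with \<open>d \<noteq> 0\<close>. If both vanish, \<open>N\<close> is
    constant, contrary to \<open>\<bar>t\<bar> \<le> N t\<close>.\<close>
  have c: "c > 0"
  proof (rule ccontr)
    assume "\<not> c > 0"
    then have "c \<le> 0" by simp
    have "c = 0"
    proof (rule ccontr)
      assume "c \<noteq> 0"
      \<comment> \<open>Adding the values at \<open>s\<close> and \<open>- s\<close> removes the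
        linear term.\<close>
      have "0 < Q s + Q (- s)" for s using Q[of s] Q[of "- s"] by simp
      then have "0 < 2 * (1 + c * s\<^sup>2)" for s by (simp add: Q_def)
      then have *: "0 < 1 + c * s\<^sup>2" for s by (simp only: zero_less_mult_iff) simp
      have "c * (sqrt (- 1 / c))\<^sup>2 = - 1"
        using \<open>c \<le> 0\<close> \<open>c \<noteq> 0\<close> by (subst real_sqrt_pow2) (auto simp: field_simps)
      then show False using *[of "sqrt (- 1 / c)"] by simp
    qed
    have "d = 0"
      using Q[of "- 1 / d"] \<open>c = 0\<close> by (cases "d = 0") (auto simp: Q_def)
    then have "(N has_real_derivative 0) (at t)" for t
      using dN[of t] g[of t] \<open>c = 0\<close> by simp
    then have "N (N 0 + 1) = N 0"
      using DERIV_isconst_all by blast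
    then show False using abs_le_N[of "N 0 + 1"] by simp
  qed
  have lim: "(M \<longlongrightarrow> 1 / c) at_infinity"
  proof (rule Lim_transform_eventually)
    have "((\<lambda>t. (N t / \<bar>t\<bar>)\<^sup>2 / ((inverse t)\<^sup>2 + d * inverse t + c)) \<longlongrightarrow> 1\<^sup>2 / (0\<^sup>2 + d * 0 + c)) at_infinity"
      using N_growth c by (intro tendsto_intros tendsto_inverse_0) (auto simp: norm_y)
    then show "((\<lambda>t. (N t / \<bar>t\<bar>)\<^sup>2 / ((inverse t)\<^sup>2 + d * inverse t + c)) \<longlongrightarrow> 1 / c) at_infinity"
      by simp
    \<comment> \<open>Dividing numerator and denominator of \<open>M\<close> by the square of
      \<open>t\<close> exposes the limit, the same at both ends.\<close>
    have "(N t / \<bar>t\<bar>)\<^sup>2 / ((inverse t)\<^sup>2 + d * inverse t + c) = M t" if "t \<noteq> 0" for t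
    proof -
      have "(inverse t)\<^sup>2 + d * inverse t + c = Q t / t\<^sup>2"
        using that by (simp add: Q_def field_simps power2_eq_square)
      then show ?thesis using that by (simp add: M_def power_divide)
    qed
    then show "\<forall>\<^sub>F t in at_infinity. (N t / \<bar>t\<bar>)\<^sup>2 / ((inverse t)\<^sup>2 + d * inverse t + c) = M t"
      unfolding eventually_at_infinity by (intro exI[of _ 1]) auto
  qed
  have ends: "(M \<longlongrightarrow> 1 / c) at_top" "(M \<longlongrightarrow> 1 / c) at_bot"
    using filterlim_mono[OF lim order_refl at_top_le_at_infinity]
      filterlim_mono[OF lim order_refl at_bot_le_at_infinity] by auto
  have M: "M t = 1 / c" for t
  proof (cases "d \<ge> 0")
    case True
    have "d * ((N r)\<^sup>2 / (Q r)\<^sup>2) \<ge> 0" for r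
      using True by (intro mult_nonneg_nonneg) auto
    then have "mono M"
      using dM by (intro monoI DERIV_nonneg_imp_nondecreasing[of _ _ M]) blast+
    then show ?thesis by (rule mono_constant_if_same_limits[OF _ ends])
  next
    case False
    have "mono (\<lambda>t. - M t)"
    proof (rule monoI)
      fix s t :: real
      assume "s \<le> t"
      moreover have "d * ((N r)\<^sup>2 / (Q r)\<^sup>2) \<le> 0" for r
        using False by (intro mult_nonpos_nonneg) auto
      ultimately have "M t \<le> M s"
        using dM by (intro DERIV_nonpos_imp_nonincreasing[of s t M]) blast+
      then show "- M s \<le> - M t" by simp
    qed
    then have "- M t = - (1 / c)"
      by (rule mono_constant_if_same_limits) (intro tendsto_minus ends)+
    then show ?thesis by simp
  qed
  have "M = (\<lambda>t. 1 / c)" using M by (rule ext)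
  then have "(M has_real_derivative 0) (at 0)" by simp
  then have "d * ((N 0)\<^sup>2 / (Q 0)\<^sup>2) = 0"
    using dM[of 0] DERIV_unique by blast
  then have d: "d = 0" using N_pos[of 0] Q[of 0] by simp
  have N2: "(N t)\<^sup>2 = Q t / c" for t
    using M[of t] Q[of t] c by (simp add: M_def field_simps)
  show thesis
  proof (rule that)
    show "1 / c > 0" using c by simp
    show "(N t)\<^sup>2 = t\<^sup>2 + 1 / c" for t
      using N2[of t] c d by (simp add: Q_def field_simps)
    show "N t * g t = t" for t
    proof -
      have "N t * g t = c * t * (N t)\<^sup>2 / Q t" by (simp add: g d power2_eq_square)
      then show ?thesis using N2[of t] c Q[of t] by simp
    qed
  qed (rule contg)
qed

section \<open>The Euclidean case\<close>

lemma norm_euclidean: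
  assumes N2: "\<And>t. (N t)\<^sup>2 = t\<^sup>2 + k"
  shows "(norm z)\<^sup>2 = k * (cx z)\<^sup>2 + (cy z)\<^sup>2"
proof (cases "cx z = 0")
  case True
  then have "norm z = \<bar>cy z\<bar>"
    using coords_decomposition[of z] norm_y
    by (metis add_0 mult.right_neutral norm_scaleR scale_zero_left)
  then show ?thesis using True by simp
next
  case False
  have "norm z = \<bar>cx z\<bar> * N (cy z / cx z)"
    using norm_combination[OF False] coords_decomposition[of z] by metis
  then have "(norm z)\<^sup>2 = (cx z)\<^sup>2 * ((cy z / cx z)\<^sup>2 + k)"
    by (simp add: power_mult_distrib N2)
  then show ?thesis using False by (simp add: distrib_left power_divide)
qed

text \<open>In the coordinates \<open>(sqrt k * cx, cy)\<close> the norm is the standard Euclidean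
  one. The flex is the velocity of a rotation about the origin combined with a translation.\<close>

lemma trivial_flex_rotation:
  assumes N2: "\<And>t. (N t)\<^sup>2 = t\<^sup>2 + k" and k: "k > 0"
    and u: "\<And>i. i \<in> V \<Longrightarrow> u i = c + (- (q / k) * cy (p i)) *\<^sub>R x + (q * cx (p i)) *\<^sub>R y"
  shows "trivial_flex V p u"
proof -
  define r where "r = sqrt k"
  have r: "r > 0" "r * r = k" using k by (auto simp: r_def)
  define rot where "rot \<theta> z =
      (cos \<theta> * cx z - sin \<theta> * cy z / r) *\<^sub>R x + (r * sin \<theta> * cx z + cos \<theta> * cy z) *\<^sub>R y" for \<theta> z
  have coords_rot: "cx (rot \<theta> z) = cos \<theta> * cx z - sin \<theta> * cy z / r"
    "cy (rot \<theta> z) = r * sin \<theta> * cx z + cos \<theta> * cy z" for \<theta> z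
    by (simp_all add: rot_def)
  have norm_rot: "norm (rot \<theta> z) = norm z" for \<theta> z
  proof -
    have "k * (cos \<theta> * cx z - sin \<theta> * cy z / r)\<^sup>2 = (r * cos \<theta> * cx z - sin \<theta> * cy z)\<^sup>2"
      using r by (simp add: r(2)[symmetric] power2_eq_square field_simps)
    then have "(norm (rot \<theta> z))\<^sup>2 = (r * cos \<theta> * cx z - sin \<theta> * cy z)\<^sup>2 + (r * sin \<theta> * cx z + cos \<theta> * cy z)\<^sup>2"
      by (simp only: norm_euclidean[OF N2] coords_rot)
    also have "\<dots> = ((sin \<theta>)\<^sup>2 + (cos \<theta>)\<^sup>2) * (r * r * (cx z)\<^sup>2 + (cy z)\<^sup>2)"
      by algebra
    also have "\<dots> = (norm z)\<^sup>2"
      by (simp add: norm_euclidean[OF N2] r)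
    finally show ?thesis by simp
  qed
  have rot_diff: "rot \<theta> z - rot \<theta> w = rot \<theta> (z - w)" for \<theta> z w
    by (rule coords_eqI) (simp_all add: coords_rot algebra_simps diff_divide_distrib)
  have rot_inverse: "rot (- \<theta>) (rot \<theta> z) = z" for \<theta> z
  proof (rule coords_eqI)
    define w where "w = cy z / r"
    have w: "cy z = r * w" using r(1) by (simp add: w_def)
    have x': "cx (rot \<theta> z) = cos \<theta> * cx z - sin \<theta> * w"
      by (simp add: coords_rot w_def)
    have y': "cy (rot \<theta> z) = r * (sin \<theta> * cx z + cos \<theta> * w)"
      by (simp add: coords_rot w algebra_simps)
    have "cx (rot (- \<theta>) (rot \<theta> z)) = cos \<theta> * cx (rot \<theta> z) + sin \<theta> * (cy (rot \<theta> z) / r)"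
      by (simp add: coords_rot(1)[of "- \<theta>" "rot \<theta> z"])
    also have "\<dots> = cos \<theta> * (cos \<theta> * cx z - sin \<theta> * w) + sin \<theta> * (sin \<theta> * cx z + cos \<theta> * w)"
      using r(1) by (simp add: x' y')
    also have "\<dots> = ((sin \<theta>)\<^sup>2 + (cos \<theta>)\<^sup>2) * cx z" by algebra
    finally show "cx (rot (- \<theta>) (rot \<theta> z)) = cx z" by simp
    have "cy (rot (- \<theta>) (rot \<theta> z)) = - r * sin \<theta> * cx (rot \<theta> z) + cos \<theta> * cy (rot \<theta> z)"
      by (simp add: coords_rot(2)[of "- \<theta>" "rot \<theta> z"])
    also have "\<dots> = ((sin \<theta>)\<^sup>2 + (cos \<theta>)\<^sup>2) * (r * w)"
      unfolding x' y' by algebra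
    finally show "cy (rot (- \<theta>) (rot \<theta> z)) = cy z" by (simp add: w)
  qed
  \<comment> \<open>This angular speed produces the coefficients \<open>- (q / k)\<close> and
    \<open>q\<close> at time 0, since \<open>r * r = k\<close>.\<close>
  define \<omega> where "\<omega> = q / r"
  define \<gamma> where "\<gamma> t z = rot (\<omega> * t) z + t *\<^sub>R c" for t z
  define D where "D t z = (- \<omega> * sin (\<omega> * t) * cx z - \<omega> * cos (\<omega> * t) * cy z / r) *\<^sub>R x
      + (r * (\<omega> * cos (\<omega> * t)) * cx z - \<omega> * sin (\<omega> * t) * cy z) *\<^sub>R y + c" for t z
  have deriv: "((\<lambda>t. \<gamma> t z) has_vector_derivative D t z) (at t)" for t z
    unfolding \<gamma>_def rot_def D_def using r(1)
    by (auto intro!: derivative_eq_intros simp: ac_simps)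
  have "isometry_map (\<gamma> t)" for t
    unfolding isometry_map_def
  proof (intro conjI allI)
    show "bij (\<gamma> t)"
    proof (rule o_bij)
      show "(\<lambda>z. rot (- (\<omega> * t)) (z - t *\<^sub>R c)) \<circ> \<gamma> t = id"
        by (auto simp: \<gamma>_def rot_inverse)
      show "\<gamma> t \<circ> (\<lambda>z. rot (- (\<omega> * t)) (z - t *\<^sub>R c)) = id"
        using rot_inverse[of "- (\<omega> * t)"] by (auto simp: \<gamma>_def)
    qed
    show "dist (\<gamma> t z) (\<gamma> t w) = dist z w" for z w
      by (simp add: \<gamma>_def dist_norm rot_diff norm_rot)
  qed
  moreover have "\<gamma> 0 = id"
    using coords_decomposition by (auto simp: \<gamma>_def rot_def)
  moreover have "(\<lambda>t. \<gamma> t z) C1_differentiable_on {-1<..<1}" for z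
    unfolding C1_differentiable_on_def using deriv r
    by (intro exI[of _ "\<lambda>t. D t z"]) (auto simp: D_def intro!: continuous_intros)
  moreover have "u i = vector_derivative (\<lambda>t. \<gamma> t (p i)) (at 0)" if "i \<in> V" for i
  proof -
    have "\<omega> * v / r = q * v / k" "r * \<omega> = q" for v using r by (auto simp: \<omega>_def)
    then have "D 0 (p i) = c + (- (q / k) * cy (p i)) *\<^sub>R x + (q * cx (p i)) *\<^sub>R y"
      by (simp add: D_def)
    then show ?thesis using u[OF that] vector_derivative_at[OF deriv] by metis
  qed
  ultimately show ?thesis
    unfolding trivial_flex_def by (intro exI[of _ \<gamma>] exI[of _ 1]) simp
qed

text \<open>For the rhombus with slopes 1 and -1 the determinant in \<open>inf_rigid_P\<close>
  vanishes. The sides remain independent, so modulo constants only the parameter \<open>q\<close> is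
  free, and it generates a rotation.\<close>

lemma inf_rigid_P_euclidean:
  assumes k: "k > 0" and N2: "\<And>t. (N t)\<^sup>2 = t\<^sup>2 + k" and gN: "\<And>t. N t * g t = t"
    and cont: "\<And>t. isCont g t"
  shows "inf_rigid (K_vertices 4) (K_edges 4) (P 1 (- 1))"
  unfolding inf_rigid_def
proof (intro conjI allI impI)
  have m: "0 = (1 + - 1) / (2 :: real)" by simp
  have ne: "(1 :: real) \<noteq> - 1" by simp
  note PI = ne m cont cont cont
  show "well_positioned (K_vertices 4) (K_edges 4) (P 1 (- 1))"
    by (rule well_positioned_P[OF PI])
  fix u
  assume flex: "inf_flex (K_vertices 4) (K_edges 4) (P 1 (- 1)) u"
  have AN: "N t * A t = k" for t
    using N2[of t] gN[of t] by (simp add: A_def power2_eq_square algebra_simps)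
  \<comment> \<open>Multiplying by \<open>N t\<close> replaces the coefficients \<open>A t\<close>
    and \<open>g t\<close> by \<open>k\<close> and \<open>t\<close>.\<close>
  have scaled: "k * a + t * b = 0" if "A t * a + g t * b = 0" for t a b
  proof -
    have "k * a + t * b = N t * (A t * a + g t * b)"
      by (simp add: distrib_left mult.assoc[symmetric] AN gN)
    then show ?thesis using that by simp
  qed
  have "g 1 > 0" "g (- 1) < 0" "A 1 > 0" "A (- 1) > 0"
    using gN[of 1] gN[of "- 1"] AN[of 1] AN[of "- 1"] N_pos[of 1] N_pos[of "- 1"] k
    by (smt (verit) zero_less_mult_iff mult_less_0_iff)+
  then have "A 1 * g (- 1) < 0" "A (- 1) * g 1 > 0" by (simp_all add: mult_pos_neg)
  then have "A 1 * g (- 1) \<noteq> A (- 1) * g 1" by linarith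
  then have para: "u 2 - u 0 = (u 1 - u 0) + (u 3 - u 0)"
    by (rule inf_flex_P_parallelogram[OF PI flex])
  define q where "q = cy (u 1 - u 0)"
  have q3: "cy (u 3 - u 0) = q"
    using inf_flex_PD(6)[OF PI flex] by (simp add: q_def)
  have "k * cx (u 1 - u 0) + 1 * q = 0"
    unfolding q_def by (rule scaled[OF inf_flex_PD(1)[OF PI flex]])
  then have x1: "cx (u 1 - u 0) = - (q / k)" using k by (simp add: field_simps)
  have "k * cx (u 3 - u 0) + (- 1) * q = 0"
    unfolding q3[symmetric] by (rule scaled[OF inf_flex_PD(3)[OF PI flex]])
  then have x3: "cx (u 3 - u 0) = q / k" using k by (simp add: field_simps)
  have "u i = u 0 + (- (q / k) * cy (P 1 (- 1) i)) *\<^sub>R x + (q * cx (P 1 (- 1) i)) *\<^sub>R y"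
    if "i \<in> K_vertices 4" for i
  proof -
    have "u 1 - u 0 = (- (q / k)) *\<^sub>R x + q *\<^sub>R y" "u 3 - u 0 = (q / k) *\<^sub>R x + q *\<^sub>R y"
      using coords_decomposition[of "u 1 - u 0"] coords_decomposition[of "u 3 - u 0"]
      unfolding x1 x3 q3 q_def[symmetric] by auto
    moreover from this have "u 2 - u 0 = (2 * q) *\<^sub>R y"
      unfolding para by (simp add: scaleR_add_left[symmetric])
    ultimately show ?thesis
      using that by (auto simp: K_vertices_def less_4_iff algebra_simps)
  qed
  then show "trivial_flex (K_vertices 4) (P 1 (- 1)) u"
    by (rule trivial_flex_rotation[OF N2 k])
qed

theorem ex_inf_rigid_K4: "\<exists>p :: nat \<Rightarrow> 'a. inf_rigid (K_vertices 4) (K_edges 4) p"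
proof (rule ccontr)
  assume nr: "\<nexists>p :: nat \<Rightarrow> 'a. inf_rigid (K_vertices 4) (K_edges 4) p"
  obtain c d where "\<And>t. g t / A t = c * t + d"
    using affine_slope_if_not_rigid[OF nr] by blast
  then obtain k where "k > 0" "\<And>t. (N t)\<^sup>2 = t\<^sup>2 + k" "\<And>t. N t * g t = t" "\<And>t. isCont g t"
    using euclidean_if_affine_slope[OF _ A_pos_if_not_rigid[OF nr]] by blast
  then show False using inf_rigid_P_euclidean nr by blast
qed

end

section \<open>Choice of coordinates\<close>

lemma dim_2_imp_plane_basis:
  assumes "dim (UNIV :: 'a::real_normed_vector set) = 2"
  obtains x y :: "'a::real_normed_vector" where "plane_basis x y"
proof -
  obtain B :: "'a set" where B: "independent B" "span B = UNIV" "card B = 2"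
    using basis_exists[of "UNIV :: 'a set"] assms by (metis top.extremum_uniqueI)
  then obtain x y where xy: "B = {x, y}" "x \<noteq> y" by (auto simp: card_2_iff)
  have "\<exists>s t. z = s *\<^sub>R x + t *\<^sub>R y" for z
  proof -
    have "z \<in> span {x, y}" using B xy by simp
    then obtain s t where "z - s *\<^sub>R x = t *\<^sub>R y"
      by (auto simp: span_insert span_breakdown_eq)
    then have "z = s *\<^sub>R x + t *\<^sub>R y" by (simp add: algebra_simps)
    then show ?thesis by blast
  qed
  moreover have "s = 0 \<and> t = 0" if "s *\<^sub>R x + t *\<^sub>R y = 0" for s t
  proof -
    have "(\<Sum>v\<in>{x, y}. (if v = x then s else t) *\<^sub>R v) = 0"
      using xy that by simp
    then have "\<forall>v\<in>{x, y}. (if v = x then s else t) = 0"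
      using B(1) xy(1) independentD[of "{x, y}" "{x, y}" "\<lambda>v. if v = x then s else t"] by auto
    then show ?thesis using xy(2) by auto
  qed
  ultimately have "plane_basis x y" by unfold_locales auto
  then show thesis by (rule that)
qed

theorem mainTheorem2:
  assumes "dim (UNIV :: 'a::real_normed_vector set) = 2"
  shows "\<exists>p :: nat \<Rightarrow> 'a. inf_rigid (K_vertices 4) (K_edges 4) p"
proof -
  obtain x0 y0 :: 'a where "plane_basis x0 y0"
    by (rule dim_2_imp_plane_basis[OF assms])
  then interpret b0: plane_basis x0 y0 .
  \<comment> \<open>The initial basis serves to find a smooth direction, from which an adapted basis
    is built.\<close>
  obtain t0 where t0: "smooth_point (x0 + t0 *\<^sub>R y0)"
    using b0.ex_smooth_point by blast
  define z where "z = x0 + t0 *\<^sub>R y0"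
  have z: "smooth_point z" "z \<noteq> 0"
    using t0 by (auto simp: z_def smooth_point_def)
  define y where "y = (1 / norm z) *\<^sub>R z"
  have y: "smooth_point y" "norm y = 1"
    using z by (auto simp: y_def intro!: smooth_point_scale)
  have supp: "support_functional y (supp_fun y)"
    by (rule support_functional_supp_fun[OF y(1)])
  \<comment> \<open>The projection of \<open>y0\<close> along \<open>y\<close> to the kernel of the
    support functional of \<open>y\<close>.\<close>
  define x where "x = y0 - supp_fun y y0 *\<^sub>R y"
  interpret f: bounded_linear "supp_fun y"
    using supp by (simp add: support_functional_def)
  have "supp_fun y y = 1" using supp y(2) by (simp add: support_functional_def)
  then have suppx: "supp_fun y x = 0" by (simp add: x_def f.diff f.scaleR)
  have zy: "z = norm z *\<^sub>R y" using z(2) by (simp add: y_def)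
  interpret b: plane_basis x y
  proof
    fix v
    obtain s t where "v = s *\<^sub>R x0 + t *\<^sub>R y0" using b0.spans by blast
    also have "\<dots> = s *\<^sub>R z + (t - s * t0) *\<^sub>R y0" by (simp add: z_def algebra_simps)
    also have "\<dots> = (t - s * t0) *\<^sub>R x + (s * norm z + (t - s * t0) * supp_fun y y0) *\<^sub>R y"
      by (subst zy) (simp add: x_def algebra_simps)
    finally show "\<exists>s t. v = s *\<^sub>R x + t *\<^sub>R y" by blast
  next
    fix s t
    assume eq: "s *\<^sub>R x + t *\<^sub>R y = 0"
    then have "supp_fun y (s *\<^sub>R x + t *\<^sub>R y) = 0" using f.zero by simp
    then have t: "t = 0" by (simp add: f.add f.scaleR suppx \<open>supp_fun y y = 1\<close>)
    \<comment> \<open>Otherwise \<open>y0\<close> would be a multiple of \<open>z\<close>, whose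
      \<open>x0\<close> coordinate is 1.\<close>
    have "x \<noteq> 0"
    proof
      assume "x = 0"
      then have "y0 = (supp_fun y y0 / norm z) *\<^sub>R (x0 + t0 *\<^sub>R y0)"
        by (simp add: x_def y_def z_def)
      then have "b0.cx y0 = supp_fun y y0 / norm z" "b0.cy y0 = supp_fun y y0 / norm z * t0"
        by (metis b0.coords_scale b0.coords_add b0.coords_basis mult.right_neutral mult_zero_right
            add.right_neutral add_0)+
      then show False by simp
    qed
    with eq t show "s = 0 \<and> t = 0" by simp
  qed
  obtain g where "\<And>s t. b.N t + g t * (s - t) \<le> b.N s"
    using convex_on_subgradient[OF b.convex_N] by blast
  then interpret b: plane_conjugate x y g
    using y suppx by unfold_locales auto
  show ?thesis by (rule b.ex_inf_rigid_K4)
qed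

end
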